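(* Let $k \ge 1$, let $I$ be an initial segment of $\mathbb{Z}^k$ with respect to the well-ordering $\prec$, and let $A \subset \mathbb{Z}^k$ be a finite, nonempty subset. If $|I| = |A|$, then $|\partial I| \le |\partial A|$.
   Context: For $A \subset \mathbb{Z}^k$, the vertex boundary is $\partial A = \{x \in \mathbb{Z}^k : \|x-a\|_\infty \le 1 \text{ for some } a \in A\}$ (so $A \subset \partial A$), where $\|x\|_\infty = \max_i |x_i|$. The well-ordering $\prec$ on $\mathbb{Z}^k$ is defined inductively. On $\mathbb{Z}^1=\mathbb{Z}$ it is $0 \prec 1 \prec -1 \prec 2 \prec -2 \prec 3 \prec \cdots$. For $k>1$ and $u=(u_1,\dots,u_k)\in\mathbb{Z}^k$, let $M(u)$ be the maximum of $\{u_1,\dots,u_k\}$ with respect to $\prec$ on $\mathbb{Z}$, and $i_u = \min\{i : u_i = M(u)\}$. For $u \ne v$ in $\mathbb{Z}^k$: (1) if $M(u) \prec M(v)$ then $u \prec v$; (2) if $M(u)=M(v)$ and $i_v < i_u$ then $u \prec v$; (3) if $M(u)=M(v)$ and $i_u=i_v$, let $u', v' \in \mathbb{Z}^{k-1}$ be obtained from $u,v$ by deleting the $i_u$-th coordinate; then $u \prec v$ if and only if $u' \prec v'$ in $\mathbb{Z}^{k-1}$. An initial segment of $\mathbb{Z}^k$ is a subset $I$ such that $v\in I$ and $u \prec v$ imply $u \in I$. *)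

theory Defs
  imports Main
begin

text \<open>Points of \<open>\<int>\<^sup>k\<close> are integer lists of length \<open>k\<close>, because the ordering is
  defined by recursion on the dimension. Coordinates are numbered from 0.\<close>

definition Zn :: "nat \<Rightarrow> int list set" where
  "Zn k = {x. length x = k}"

definition linf_norm :: "int list \<Rightarrow> int" where
  "linf_norm x = Max (abs ` set x)"

definition vertex_boundary :: "nat \<Rightarrow> int list set \<Rightarrow> int list set" where
  "vertex_boundary k A = {x \<in> Zn k. \<exists>a\<in>A. linf_norm (map2 (-) x a) \<le> 1}"

text \<open>The position of an integer in the enumeration \<open>0, 1, -1, 2, -2, 3, \<dots>\<close>, counted from 0.\<close>

definition int_pos :: "int \<Rightarrow> nat" where
  "int_pos z = (if z > 0 then nat (2 * z - 1) else nat (- 2 * z))"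

definition int_prec :: "int \<Rightarrow> int \<Rightarrow> bool" where
  "int_prec a b \<longleftrightarrow> int_pos a < int_pos b"

definition max_coord :: "int list \<Rightarrow> int" where
  "max_coord u = (THE m. m \<in> set u \<and> (\<forall>x\<in>set u. x = m \<or> int_prec x m))"

definition max_index :: "int list \<Rightarrow> nat" where
  "max_index u = (LEAST i. i < length u \<and> u ! i = max_coord u)"

definition delete_coord :: "nat \<Rightarrow> int list \<Rightarrow> int list" where
  "delete_coord i u = take i u @ drop (Suc i) u"

text \<open>The value in dimension 0 is a dummy.\<close>

fun prec :: "nat \<Rightarrow> int list \<Rightarrow> int list \<Rightarrow> bool" where
  "prec 0 u v \<longleftrightarrow> False"
| "prec (Suc 0) u v \<longleftrightarrow> int_prec (u ! 0) (v ! 0)"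
| "prec (Suc (Suc k)) u v \<longleftrightarrow>
     u \<noteq> v \<and>
     (int_prec (max_coord u) (max_coord v) \<or>
      max_coord u = max_coord v \<and> max_index v < max_index u \<or>
      max_coord u = max_coord v \<and> max_index u = max_index v \<and>
        prec (Suc k) (delete_coord (max_index u) u) (delete_coord (max_index v) v))"

definition initial_segment :: "nat \<Rightarrow> int list set \<Rightarrow> bool" where
  "initial_segment k I \<longleftrightarrow>
     I \<subseteq> Zn k \<and> (\<forall>v\<in>I. \<forall>u\<in>Zn k. prec k u v \<longrightarrow> u \<in> I)"

end

theory Submission
  imports Defs "HOL-Library.FuncSet" "HOL-Library.Nat_Bijection"
begin

text \<open>
  Replacing every coordinate by its position in \<open>0, 1, -1, 2, -2, \<dots>\<close> turns \<open>\<int>\<^sup>k\<close> into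
  the functions \<open>u\<close> from \<open>{..<k}\<close> to the naturals. Two facts make this picture easy to handle.

  The ordering becomes an additive one. Iterating the rules ``largest coordinate, then its first
  index, then the rest'' compares the sets of pairs \<open>(u i, i)\<close> colexicographically, where pairs are
  sorted by value and, for equal values, the smaller index is the larger pair. Numbering
  the pairs by \<open>place K i t\<close>, this is the comparison of the numbers
  \<open>wt K S u = (\<Sum>i\<in>S. 2 ^ place K i (u i))\<close>: a coordinate shared by two points simply
  cancels (\<open>prec_iff_wt_less\<close>).

  The boundary of a down-closed set is a weighted count. The least neighbour of position \<open>p\<close> is
  \<open>p - 2\<close> (truncated), and every neighbour is at least that. So \<open>p\<close> lies in the
  boundary of a down-closed \<open>A\<close> iff \<open>p - 2\<close>, taken coordinatewise, lies in \<open>A\<close>, and \<open>u \<in> A\<close> is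
  responsible for \<open>3 ^ z\<close> boundary points, \<open>z\<close> being its number of zero coordinates
  (\<open>card_bdry_down_closed\<close>).

  The proof is by induction on the number of coordinates. Among the sets of the given size with
  boundary no larger than that of \<open>A\<close>, take one whose total weight is least; call it optimal.
  Pushing all columns of an optimal set down to initial intervals, or replacing all its
  slices by initial segments of the same size, which is where the induction hypothesis enters,
  does not increase the boundary and would lower the weight if it changed anything. So an optimal set is down-closed and all
  its slices are initial segments (\<open>optimal_columns\<close>, \<open>optimal_slices\<close>).

  It remains to see that such a set is an initial segment (\<open>optimal_initial\<close>). If not, let
  \<open>x\<close> be its last point and \<open>y\<close> the first point missing, so \<open>y\<close> precedes \<open>x\<close>. Trading
  \<open>x\<close> for \<open>y\<close> is forbidden by optimality, hence \<open>y\<close> has more zeros than \<open>x\<close>. Since slices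
  are initial segments, \<open>x\<close> and \<open>y\<close> share no coordinate, and more precisely
  \<open>x j < y j\<close> for all \<open>j\<close> except the index \<open>c\<close> of the largest pair of \<open>x\<close>. Thus \<open>y c = 0\<close> is the only zero
  of \<open>y\<close>, and \<open>x\<close> has no zero. Now a whole line can be traded: lower the smallest coordinate
  \<open>q\<close> of \<open>x\<close> through all values down to \<open>0\<close>, and instead
  raise the coordinate \<open>c\<close> of \<open>y\<close> through the values \<open>0, \<dots>, x q\<close>. Zeros are matched with zeros, so the
  boundary has the same size, and the weight drops: a contradiction.
\<close>

section \<open>Integers by their position\<close>

definition int_at :: "nat \<Rightarrow> int" where
  "int_at n = (if odd n then int ((n + 1) div 2) else - int (n div 2))"

lemma int_pos_int_at [simp]: "int_pos (int_at n) = n"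
  unfolding int_pos_def int_at_def by (auto elim!: oddE evenE)

lemma int_at_int_pos [simp]: "int_at (int_pos z) = z"
proof (cases "z > 0")
  case True
  then obtain m where "z = int (Suc m)" by (metis zero_less_imp_eq_int gr0_implies_Suc)
  then show ?thesis by (simp add: int_pos_def int_at_def nat_add_distrib nat_mult_distrib)
next
  case False
  then obtain m where "z = - int m" by (metis int_cases2 linorder_not_less of_nat_less_0_iff
        minus_minus neg_0_less_iff_less nonneg_int_cases)
  then show ?thesis by (simp add: int_pos_def int_at_def nat_mult_distrib)
qed

text \<open>Adjacency of two integers, expressed through their positions.\<close>

definition near :: "nat \<Rightarrow> nat \<Rightarrow> bool" where
  "near p q \<longleftrightarrow> \<bar>int_at p - int_at q\<bar> \<le> 1"

lemma near_le: "near p q \<Longrightarrow> p \<le> q + 2"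
  unfolding near_def int_at_def by (auto elim!: oddE evenE split: if_splits)

lemma near_minus_2: "near p (p - 2)"
proof -
  consider "p = 0" | "p = 1" | m where "p = m + 2"
    by (metis One_nat_def add_2_eq_Suc' not0_implies_Suc)
  then show ?thesis by cases (auto simp: near_def int_at_def)
qed

lemma near_finite: "finite {s. near s t}"
  by (rule finite_subset[of _ "{..t+2}"]) (auto dest: near_le)

lemma finite_near: "finite R \<Longrightarrow> finite {s. \<exists>r\<in>R. near s r}"
  using finite_UN_I[of R "\<lambda>r. {s. near s r}"] near_finite
  by (simp add: Collect_bex_eq)

text \<open>The one-dimensional inequality: the successor of the maximum and the predecessor of the
  minimum are new.\<close>

lemma card_near_ge:
  assumes "finite R" "R \<noteq> {}"
  shows "card R + 2 \<le> card {s. \<exists>r\<in>R. near s r}"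
proof -
  define Z where "Z = int_at ` R"
  have inj: "inj int_at" by (metis injI int_pos_int_at)
  have injp: "inj int_pos" by (metis injI int_at_int_pos)
  have Z: "finite Z" "Z \<noteq> {}" using assms by (auto simp: Z_def)
  have out: "Max Z + 1 \<notin> Z" "Min Z - 1 \<notin> insert (Max Z + 1) Z"
    using Max_ge[OF Z(1), of "Max Z + 1"] Min_le[OF Z(1), of "Min Z - 1"] Min_le[OF Z(1) Max_in[OF Z]]
    by (fastforce, smt (verit) insertE)
  have "card R + 2 = card Z + 2"
    unfolding Z_def using inj by (simp add: card_image inj_on_subset)
  also have "\<dots> = card (insert (Min Z - 1) (insert (Max Z + 1) Z))"
    using Z out by simp
  also have "\<dots> = card (int_pos ` insert (Min Z - 1) (insert (Max Z + 1) Z))"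
    using injp by (metis card_image inj_on_subset subset_UNIV)
  also have "\<dots> \<le> card {s. \<exists>r\<in>R. near s r}"
  proof (rule card_mono)
    show "finite {s. \<exists>r\<in>R. near s r}" using assms(1) by (rule finite_near)
    have "\<exists>r\<in>R. near (int_pos z) r" if "\<exists>y\<in>Z. \<bar>z - y\<bar> \<le> 1" for z
      using that by (auto simp: near_def Z_def)
    moreover have "\<exists>y\<in>Z. \<bar>z - y\<bar> \<le> 1"
      if "z \<in> insert (Min Z - 1) (insert (Max Z + 1) Z)" for z
      using that Min_in[OF Z] Max_in[OF Z] by force
    ultimately show "int_pos ` insert (Min Z - 1) (insert (Max Z + 1) Z) \<subseteq> {s. \<exists>r\<in>R. near s r}"
      by blast
  qed
  finally show ?thesis .
qed

section \<open>The grid and the weight that defines its order\<close>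

text \<open>Points with coordinates indexed by \<open>S\<close> vanish outside \<open>S\<close>, so that deleting coordinate
  \<open>i\<close> is the update \<open>u(i := 0)\<close> and indices never have to be shifted.\<close>

definition grid :: "nat set \<Rightarrow> (nat \<Rightarrow> nat) set" where
  "grid S = {u. \<forall>i. i \<notin> S \<longrightarrow> u i = 0}"

definition bdry :: "nat set \<Rightarrow> (nat \<Rightarrow> nat) set \<Rightarrow> (nat \<Rightarrow> nat) set" where
  "bdry S A = {p \<in> grid S. \<exists>a\<in>A. \<forall>i\<in>S. near (p i) (a i)}"

text \<open>For indices below \<open>K\<close> the map \<open>(i, t) \<mapsto> place K i t\<close> numbers the pairs injectively: larger values
  get larger numbers, and among equal values the smaller index does. A fixed \<open>K\<close> serves all index
  sets \<open>S \<subseteq> {..<K}\<close>, which keeps the order compatible with passing to slices.\<close>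

definition place :: "nat \<Rightarrow> nat \<Rightarrow> nat \<Rightarrow> nat" where
  "place K i t = K * t + (K - 1 - i)"

definition wt :: "nat \<Rightarrow> nat set \<Rightarrow> (nat \<Rightarrow> nat) \<Rightarrow> nat" where
  "wt K S u = (\<Sum>i\<in>S. 2 ^ place K i (u i))"

definition initial :: "nat \<Rightarrow> nat set \<Rightarrow> (nat \<Rightarrow> nat) set \<Rightarrow> bool" where
  "initial K S J \<longleftrightarrow> J \<subseteq> grid S \<and> (\<forall>u\<in>J. \<forall>v\<in>grid S. wt K S v < wt K S u \<longrightarrow> v \<in> J)"

lemma grid_upd: "u \<in> grid S \<Longrightarrow> i \<in> S \<Longrightarrow> u(i := t) \<in> grid S"
  by (auto simp: grid_def)

lemma grid_delete: "u \<in> grid S \<Longrightarrow> u(i := 0) \<in> grid (S - {i})"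
  by (auto simp: grid_def)

lemma grid_insert: "u \<in> grid (S - {i}) \<Longrightarrow> i \<in> S \<Longrightarrow> u(i := t) \<in> grid S"
  by (auto simp: grid_def)

lemma grid_le: "u \<in> grid S \<Longrightarrow> v \<le> u \<Longrightarrow> v \<in> grid S"
  by (auto simp: grid_def le_fun_def) (metis le_zero_eq)

lemma grid_eqI: "u \<in> grid S \<Longrightarrow> v \<in> grid S \<Longrightarrow> (\<And>i. i \<in> S \<Longrightarrow> u i = v i) \<Longrightarrow> u = v"
  by (rule ext) (metis (mono_tags, lifting) grid_def mem_Collect_eq)

lemma finite_bdry:
  assumes "finite S" "finite A"
  shows "finite (bdry S A)"
proof -
  have "bdry S A \<subseteq> (\<Union>a\<in>A. {p. \<forall>i. (i \<in> S \<longrightarrow> p i \<in> {..(\<Sum>j\<in>S. a j) + 2}) \<and> (i \<notin> S \<longrightarrow> p i = 0)})"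
  proof
    fix p assume "p \<in> bdry S A"
    then obtain a where a: "a \<in> A" "p \<in> grid S" "\<forall>i\<in>S. near (p i) (a i)" by (auto simp: bdry_def)
    have "p i \<le> (\<Sum>j\<in>S. a j) + 2" if "i \<in> S" for i
      using near_le[of "p i" "a i"] a that member_le_sum[of i S a] assms by fastforce
    then show "p \<in> (\<Union>a\<in>A. {p. \<forall>i. (i \<in> S \<longrightarrow> p i \<in> {..(\<Sum>j\<in>S. a j) + 2}) \<and> (i \<notin> S \<longrightarrow> p i = 0)})"
      using a by (auto simp: grid_def)
  qed
  then show ?thesis
    by (rule finite_subset) (intro finite_UN_I assms finite_set_of_finite_funs finite_atMost)
qed

lemma upd_mem_bdry_iff:
  assumes "i \<in> S" "w \<in> grid (S - {i})"
  shows "w(i := s) \<in> bdry S A \<longleftrightarrow> (\<exists>a\<in>A. near s (a i) \<and> (\<forall>j\<in>S - {i}. near (w j) (a j)))"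
proof -
  have "(\<forall>j\<in>S. near ((w(i := s)) j) (a j)) \<longleftrightarrow> near s (a i) \<and> (\<forall>j\<in>S - {i}. near (w j) (a j))" for a
    using assms(1) by (auto split: if_splits)
  then show ?thesis using grid_insert[OF assms(2,1)] by (simp add: bdry_def)
qed

lemma bdry_mono: "A \<subseteq> B \<Longrightarrow> bdry S A \<subseteq> bdry S B"
  by (auto simp: bdry_def)

lemma place_less_iff:
  assumes "i < K" "j < K"
  shows "place K i s < place K j t \<longleftrightarrow> s < t \<or> s = t \<and> j < i"
proof (cases s t rule: linorder_cases)
  case less
  then have "K * Suc s \<le> K * t" by (intro mult_le_mono2) simp
  then show ?thesis using assms less by (auto simp: place_def)
next
  case greater
  then have "K * Suc t \<le> K * s" by (intro mult_le_mono2) simp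
  then show ?thesis using assms greater by (auto simp: place_def)
qed (use assms in \<open>auto simp: place_def\<close>)

lemma place_eq_iff:
  assumes "i < K" "j < K"
  shows "place K i s = place K j t \<longleftrightarrow> s = t \<and> i = j"
  using place_less_iff[of i K j s t] place_less_iff[of j K i t s] assms
  by (metis linorder_less_linear less_irrefl)

lemma sum_distinct_powers_less:
  assumes "inj_on p I" "\<And>i. i \<in> I \<Longrightarrow> p i < N"
  shows "(\<Sum>i\<in>I. 2 ^ p i) < (2::nat) ^ N"
proof -
  have "(\<Sum>i\<in>I. 2 ^ p i) = (\<Sum>n\<in>p ` I. (2::nat) ^ n)" using assms(1) by (simp add: sum.reindex)
  also have "\<dots> \<le> (\<Sum>n<N. 2 ^ n)" using assms(2) by (intro sum_mono2) auto
  also have "\<dots> < (2::nat) ^ N" by (induction N) auto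
  finally show ?thesis .
qed

lemma inj_on_place:
  assumes "S \<subseteq> {..<K}"
  shows "inj_on (\<lambda>i. place K i (u i)) S"
  using assms by (auto simp: inj_on_def place_eq_iff subset_iff)

text \<open>Weights are binary numerals, so comparing them is comparing the sets of numbered pairs
  colexicographically; injectivity of binary representation makes the order total.\<close>

lemma wt_eq_set_encode:
  assumes "S \<subseteq> {..<K}"
  shows "wt K S u = set_encode ((\<lambda>i. place K i (u i)) ` S)"
  using inj_on_place[OF assms] by (simp add: set_encode_def wt_def sum.reindex)

lemma wt_less_power:
  assumes "S \<subseteq> {..<K}" "\<And>i. i \<in> S \<Longrightarrow> place K i (u i) < N"
  shows "wt K S u < 2 ^ N"
  unfolding wt_def using inj_on_place[OF assms(1)] assms(2) by (rule sum_distinct_powers_less)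

lemma place_power_le_wt:
  assumes "finite S" "i \<in> S"
  shows "2 ^ place K i (u i) \<le> wt K S u"
  unfolding wt_def using assms member_le_sum[of i S "\<lambda>i. 2 ^ place K i (u i) :: nat"] by simp

lemma wt_inj:
  assumes "S \<subseteq> {..<K}" "u \<in> grid S" "v \<in> grid S" "wt K S u = wt K S v"
  shows "u = v"
proof -
  have fin: "finite S" using assms(1) finite_subset by blast
  have "(\<lambda>i. place K i (u i)) ` S = (\<lambda>i. place K i (v i)) ` S"
    using assms fin by (simp add: wt_eq_set_encode set_encode_eq)
  then have "u i = v i" if "i \<in> S" for i
    using that assms(1) by (auto simp: set_eq_iff image_iff subset_iff) (metis place_eq_iff lessThan_iff)
  then show ?thesis using grid_eqI assms by blast
qed

lemma wt_upd:
  assumes "finite S" "i \<in> S"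
  shows "wt K S (u(i := t)) = 2 ^ place K i t + wt K (S - {i}) u"
  unfolding wt_def using assms by (subst sum.remove[of _ i]) (auto intro!: sum.cong)

lemma place_mono: "s \<le> t \<Longrightarrow> place K i s \<le> place K i t"
  by (simp add: place_def)

lemma place_strict_mono: "i < K \<Longrightarrow> s < t \<Longrightarrow> place K i s < place K i t"
  by (simp add: place_less_iff)

lemma wt_mono: "u \<le> v \<Longrightarrow> wt K S u \<le> wt K S v"
  unfolding wt_def by (intro sum_mono power_increasing place_mono) (auto simp: le_fun_def)

lemma wt_strict_mono:
  assumes "S \<subseteq> {..<K}" "v \<in> grid S" "u \<le> v" "u \<noteq> v"
  shows "wt K S u < wt K S v"
  using wt_mono[OF assms(3), of K S] wt_inj[OF assms(1) grid_le[OF assms(2,3)] assms(2)] assms(4)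
  by fastforce

text \<open>Neither of a point of \<open>I - J\<close> and a point of \<open>J - I\<close> can precede the other.\<close>

lemma initial_chain:
  assumes "S \<subseteq> {..<K}" "initial K S I" "initial K S J"
  shows "I \<subseteq> J \<or> J \<subseteq> I"
proof (rule ccontr)
  assume "\<not> ?thesis"
  then obtain u v where uv: "u \<in> I" "u \<notin> J" "v \<in> J" "v \<notin> I" by blast
  then have "u \<in> grid S" "v \<in> grid S" "\<not> wt K S u < wt K S v" "\<not> wt K S v < wt K S u"
    using assms by (auto simp: initial_def)
  then have "u = v" using wt_inj[OF assms(1), of u v] by simp
  then show False using uv by simp
qed

lemma initial_subset_if_card_le:
  assumes "S \<subseteq> {..<K}" "initial K S I" "initial K S J" "finite I" "card I \<le> card J"
  shows "I \<subseteq> J"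
  using initial_chain[OF assms(1-3)] assms(4,5) by (metis card_seteq order_refl)

text \<open>The principle behind both compressions below: trading elements for strictly lighter ones
  lowers the total weight.\<close>

lemma sum_less_exchange:
  fixes w :: "'a \<Rightarrow> nat"
  assumes "finite A" "finite B" "card A = card B" "A \<noteq> B"
    and less: "\<And>x y. x \<in> B - A \<Longrightarrow> y \<in> A - B \<Longrightarrow> w x < w y"
  shows "sum w B < sum w A"
proof -
  have card: "card (A - B) = card (B - A)"
    using assms(1-3) by (simp add: card_Diff_subset_Int Int_commute)
  have ne: "B - A \<noteq> {}" "A - B \<noteq> {}"
    using assms(1-4) card by (metis Diff_eq_empty_iff card_subset_eq)+
  define m where "m = Max (w ` (B - A))"
  have m: "w x \<le> m" if "x \<in> B - A" for x unfolding m_def using that assms(2) by simp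
  have "m \<in> w ` (B - A)" unfolding m_def using ne assms(2) by (intro Max_in) auto
  then have m2: "Suc m \<le> w y" if "y \<in> A - B" for y using less that by (metis Suc_leI image_iff)
  have "sum w (B - A) \<le> card (B - A) * m" using sum_bounded_above[of "B - A" w m] m by simp
  also have "\<dots> < card (A - B) * Suc m" using card ne assms(1,2) by (simp add: card_gt_0_iff)
  also have "\<dots> \<le> sum w (A - B)" using sum_bounded_below[of "A - B" "Suc m" w] m2 by simp
  finally have "sum w (B - A) < sum w (A - B)" .
  moreover have "sum w A = sum w (A \<inter> B) + sum w (A - B)"
    using assms(1) by (metis sum.Int_Diff)
  moreover have "sum w B = sum w (A \<inter> B) + sum w (B - A)"
    using assms(2) by (metis sum.Int_Diff Int_commute)
  ultimately show ?thesis by simp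
qed

section \<open>Optimal sets are compressed\<close>

definition slice :: "nat \<Rightarrow> nat \<Rightarrow> (nat \<Rightarrow> nat) set \<Rightarrow> (nat \<Rightarrow> nat) set" where
  "slice i t A = {v. v i = 0 \<and> v(i := t) \<in> A}"

definition column :: "nat \<Rightarrow> (nat \<Rightarrow> nat) \<Rightarrow> (nat \<Rightarrow> nat) set \<Rightarrow> nat set" where
  "column i v A = {t. v(i := t) \<in> A}"

lemma sum_columns:
  fixes f :: "(nat \<Rightarrow> nat) \<Rightarrow> nat"
  assumes "finite A" "finite V" "(\<lambda>u. u(i := 0)) ` A \<subseteq> V" "\<And>v. v \<in> V \<Longrightarrow> v i = 0"
  shows "sum f A = (\<Sum>v\<in>V. \<Sum>t\<in>column i v A. f (v(i := t)))"
proof -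
  have "(\<Sum>t\<in>column i v A. f (v(i := t))) = sum f {u \<in> A. u(i := 0) = v}" if "v \<in> V" for v
  proof -
    have "{u \<in> A. u(i := 0) = v} = (\<lambda>t. v(i := t)) ` column i v A"
      using assms(4)[OF that]
      by (auto simp: column_def image_iff) (metis fun_upd_triv)+
    moreover have "inj_on (\<lambda>t. v(i := t)) (column i v A)"
      by (auto simp: inj_on_def dest: fun_cong[where x=i])
    ultimately show ?thesis by (simp add: sum.reindex)
  qed
  then show ?thesis using sum.group[OF assms(1-3), of f] by simp
qed

lemma sum_slices:
  fixes f :: "(nat \<Rightarrow> nat) \<Rightarrow> nat"
  assumes "finite A" "finite T" "(\<lambda>u. u i) ` A \<subseteq> T"
  shows "sum f A = (\<Sum>t\<in>T. \<Sum>v\<in>slice i t A. f (v(i := t)))"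
proof -
  have "(\<Sum>v\<in>slice i t A. f (v(i := t))) = sum f {u \<in> A. u i = t}" for t
  proof -
    have "{u \<in> A. u i = t} = (\<lambda>v. v(i := t)) ` slice i t A"
      by (auto simp: slice_def image_iff)
        (metis fun_upd_same fun_upd_triv fun_upd_upd)+
    moreover have "inj_on (\<lambda>v. v(i := t)) (slice i t A)"
      by (auto simp: inj_on_def slice_def fun_eq_iff) metis
    ultimately show ?thesis by (simp add: sum.reindex)
  qed
  then show ?thesis using sum.group[OF assms, of f] by simp
qed

text \<open>The weight serves as a potential: a compression or an exchange that does not enlarge the
  boundary must not lower it.\<close>

definition optimal :: "nat \<Rightarrow> nat set \<Rightarrow> (nat \<Rightarrow> nat) set \<Rightarrow> bool" where
  "optimal K S A \<longleftrightarrow> A \<subseteq> grid S \<and> finite A \<and>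
     (\<forall>B. B \<subseteq> grid S \<longrightarrow> finite B \<longrightarrow> card B = card A \<longrightarrow> card (bdry S B) \<le> card (bdry S A) \<longrightarrow>
        sum (wt K S) A \<le> sum (wt K S) B)"

lemma optimal_exists:
  assumes "A \<subseteq> grid S" "finite A"
  obtains B where "optimal K S B" "card B = card A" "card (bdry S B) \<le> card (bdry S A)"
proof -
  define P where "P B \<longleftrightarrow> B \<subseteq> grid S \<and> finite B \<and> card B = card A \<and> card (bdry S B) \<le> card (bdry S A)" for B
  have "P A" using assms by (simp add: P_def)
  then obtain B where B: "P B" "\<And>C. P C \<Longrightarrow> sum (wt K S) B \<le> sum (wt K S) C"
    using ex_has_least_nat[of P A "sum (wt K S)"] by blast
  have "optimal K S B"
    unfolding optimal_def
  proof (intro conjI allI impI)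
    fix C assume "C \<subseteq> grid S" "finite C" "card C = card B" "card (bdry S C) \<le> card (bdry S B)"
    then have "P C" using B(1) by (simp add: P_def)
    then show "sum (wt K S) B \<le> sum (wt K S) C" by (rule B(2))
  qed (use B(1) in \<open>auto simp: P_def\<close>)
  then show ?thesis using B that by (auto simp: P_def)
qed

lemma sum_initial_interval:
  assumes "finite C" "C \<noteq> {..<card C}" "i < K"
  shows "(\<Sum>t<card C. 2 ^ place K i t) < (\<Sum>t\<in>C. 2 ^ place K i t :: nat)"
proof (rule sum_less_exchange)
  fix s t assume "s \<in> {..<card C} - C" "t \<in> C - {..<card C}"
  then have "s < t" by auto
  then show "(2::nat) ^ place K i s < 2 ^ place K i t"
    using place_strict_mono[OF assms(3)] by simp
qed (use assms in auto)

text \<open>Push every column in direction \<open>i\<close> down to the interval of the same length. Over a point \<open>w\<close> of the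
  smaller grid, let \<open>C\<close> be the set of heights occurring in columns adjacent to \<open>w\<close>. The boundary of
  \<open>A\<close> has at least \<open>card C + 2\<close> points over \<open>w\<close> by the one-dimensional inequality, while after
  pushing down every adjacent column has height at most \<open>card C\<close>, so the boundary stays
  below \<open>card C + 2\<close>. Nothing moves when \<open>A\<close> is optimal, so its columns are intervals already.\<close>

lemma optimal_columns:
  assumes opt: "optimal K S A" and S: "S \<subseteq> {..<K}" and "i \<in> S" and "u \<in> A" "t \<le> u i"
  shows "u(i := t) \<in> A"
proof -
  have A: "A \<subseteq> grid S" "finite A" using opt by (auto simp: optimal_def)
  have finS: "finite S" using S finite_subset by blast
  have "i < K" using S assms(3) by auto
  define V where "V = (\<lambda>u. u(i := 0)) ` A"
  define D where "D = {u. u(i := 0) \<in> V \<and> u i < card (column i (u(i := 0)) A)}"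
  have finV: "finite V" using A by (simp add: V_def)
  have V0: "v i = 0" if "v \<in> V" for v using that by (auto simp: V_def)
  have Vgrid: "v \<in> grid (S - {i})" if "v \<in> V" for v using that A by (auto simp: V_def grid_delete)
  have fincol: "finite (column i v B)" if "finite B" for v B
  proof (rule inj_on_finite[of "\<lambda>t. v(i := t)" _ B])
    show "inj_on (\<lambda>t. v(i := t)) (column i v B)" by (auto simp: inj_on_def dest: fun_cong[where x=i])
  qed (use that in \<open>auto simp: column_def\<close>)
  have colD: "column i v D = {..<card (column i v A)}" if "v \<in> V" for v
    using V0[OF that] that by (auto simp: column_def D_def fun_upd_idem)
  have Dgrid: "D \<subseteq> grid S"
    using Vgrid grid_insert[OF _ assms(3)] unfolding D_def
    by (auto) (metis fun_upd_triv fun_upd_upd)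
  have finD: "finite D"
  proof (rule finite_subset)
    show "D \<subseteq> (\<lambda>(v,t). v(i := t)) ` (SIGMA v:V. {..<card (column i v A)})"
    proof
      fix u assume "u \<in> D"
      then have "(u(i := 0), u i) \<in> (SIGMA v:V. {..<card (column i v A)})" by (simp add: D_def)
      then show "u \<in> (\<lambda>(v,t). v(i := t)) ` (SIGMA v:V. {..<card (column i v A)})"
        by (rule rev_image_eqI) simp
    qed
  qed (use finV in auto)
  have DV: "(\<lambda>u. u(i := 0)) ` D \<subseteq> V" by (auto simp: D_def)
  have cardA: "card A = (\<Sum>v\<in>V. card (column i v A))"
    using sum_columns[where i = i and f = "\<lambda>_. 1" and A = A and V = V] A(2) finV V0 by (simp add: V_def)
  have cardD: "card D = card A"
    using sum_columns[where i = i and f = "\<lambda>_. 1", OF finD finV DV] V0 cardA colD by simp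
  define W where "W = (\<lambda>u. u(i := 0)) ` (bdry S A \<union> bdry S D)"
  have finW: "finite W" using finite_bdry[OF finS] A finD by (simp add: W_def)
  have W0: "w i = 0" if "w \<in> W" for w using that by (auto simp: W_def)
  have Wgrid: "w \<in> grid (S - {i})" if "w \<in> W" for w
    using that by (auto simp: W_def bdry_def grid_delete)
  have "card (column i w (bdry S D)) \<le> card (column i w (bdry S A))" if "w \<in> W" for w
  proof (cases "column i w (bdry S D) = {}")
    case False
    define C where "C = {t. \<exists>a\<in>A. a i = t \<and> (\<forall>j\<in>S - {i}. near (w j) (a j))}"
    have C: "C \<subseteq> (\<lambda>a. a i) ` A" by (auto simp: C_def)
    then have finC: "finite C" using A finite_surj by blast
    have key: "C \<noteq> {} \<and> p < card C + 2" if p: "p \<in> column i w (bdry S D)" for p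
    proof -
      obtain d where d: "d \<in> D" "near p (d i)" "\<forall>j\<in>S - {i}. near (w j) (d j)"
        using p upd_mem_bdry_iff[OF assms(3) Wgrid[OF \<open>w \<in> W\<close>], of p D] by (auto simp: column_def)
      have "column i (d(i := 0)) A \<subseteq> C"
      proof
        fix t assume "t \<in> column i (d(i := 0)) A"
        then have "d(i := t) \<in> A" by (simp add: column_def)
        moreover have "\<forall>j\<in>S - {i}. near (w j) ((d(i := t)) j)" using d(3) by auto
        ultimately show "t \<in> C"
          unfolding C_def mem_Collect_eq by (intro bexI[of _ "d(i := t)"] conjI) simp_all
      qed
      then have "card (column i (d(i := 0)) A) \<le> card C" using finC by (rule card_mono[rotated])
      moreover have "d i < card (column i (d(i := 0)) A)" using d(1) by (simp add: D_def)
      moreover have "p \<le> d i + 2" using d(2) by (rule near_le)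
      ultimately show ?thesis by auto
    qed
    then have "card (column i w (bdry S D)) \<le> card {..<card C + 2}"
      by (intro card_mono) auto
    also have "\<dots> = card C + 2" by simp
    also have "\<dots> \<le> card {s. \<exists>r\<in>C. near s r}" using finC False key by (intro card_near_ge) auto
    also have "\<dots> \<le> card (column i w (bdry S A))"
    proof (rule card_mono)
      show "finite (column i w (bdry S A))" using fincol finite_bdry finS A by blast
      show "{s. \<exists>r\<in>C. near s r} \<subseteq> column i w (bdry S A)"
        using upd_mem_bdry_iff[OF assms(3) Wgrid[OF that], of _ A] by (auto simp: C_def column_def)
    qed
    finally show ?thesis .
  qed simp
  then have "(\<Sum>w\<in>W. card (column i w (bdry S D))) \<le> (\<Sum>w\<in>W. card (column i w (bdry S A)))"
    by (rule sum_mono)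
  moreover have "card (bdry S B) = (\<Sum>w\<in>W. card (column i w (bdry S B)))" if "B \<in> {A, D}" for B
    using sum_columns[where i = i and f = "\<lambda>_. 1" and A = "bdry S B", OF _ finW] W0 finite_bdry[OF finS] A(2) finD that
    by (auto simp: W_def)
  ultimately have "card (bdry S D) \<le> card (bdry S A)" by simp
  then have opt_le: "sum (wt K S) A \<le> sum (wt K S) D"
    using opt Dgrid finD cardD by (auto simp: optimal_def)
  have col_wt: "sum (wt K S) B = (\<Sum>v\<in>V. (\<Sum>t\<in>column i v B. 2 ^ place K i t) + card (column i v B) * wt K (S - {i}) v)"
    if "finite B" "(\<lambda>u. u(i := 0)) ` B \<subseteq> V" for B
    using sum_columns[where i = i and f = "wt K S", OF that(1) finV that(2)] V0
    by (simp add: wt_upd[OF finS assms(3)] sum.distrib)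
  have "column i v A = {..<card (column i v A)}" if "v \<in> V" for v
  proof (rule ccontr)
    assume ne: "column i v A \<noteq> {..<card (column i v A)}"
    have le: "(\<Sum>t\<in>column i v D. 2 ^ place K i t) \<le> (\<Sum>t\<in>column i v A. 2 ^ place K i t :: nat)"
      if "v \<in> V" for v
      using sum_initial_interval[OF fincol[OF A(2)] _ \<open>i < K\<close>, of v] colD[OF that]
      by (metis less_imp_le order_refl)
    have "sum (wt K S) D < sum (wt K S) A"
      unfolding col_wt[OF finD DV] col_wt[OF A(2) V_def[symmetric, THEN equalityD1]]
    proof (rule sum_strict_mono_ex1[OF finV])
      show "\<forall>v\<in>V. (\<Sum>t\<in>column i v D. 2 ^ place K i t) + card (column i v D) * wt K (S - {i}) v
         \<le> (\<Sum>t\<in>column i v A. 2 ^ place K i t) + card (column i v A) * wt K (S - {i}) v"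
        using le colD by simp
      show "\<exists>v\<in>V. (\<Sum>t\<in>column i v D. 2 ^ place K i t) + card (column i v D) * wt K (S - {i}) v
         < (\<Sum>t\<in>column i v A. 2 ^ place K i t) + card (column i v A) * wt K (S - {i}) v"
        using sum_initial_interval[OF fincol[OF A(2)] ne \<open>i < K\<close>] colD that by (intro bexI[of _ v]) auto
    qed
    then show False using opt_le by simp
  qed
  moreover have "u(i := 0) \<in> V" using assms(4) by (simp add: V_def)
  moreover have "u i \<in> column i (u(i := 0)) A" using assms(4) by (simp add: column_def)
  ultimately have "t \<in> column i (u(i := 0)) A" using assms(5)
    by (metis lessThan_iff order_le_less_trans)
  then show ?thesis by (simp add: column_def)
qed

text \<open>Replace every slice in direction \<open>i\<close> by the initial segment of the same size. A slice of the
  boundary is the union of the boundaries of the adjacent slices. For initial segments these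
  slices form a chain, so that the union is the boundary of the largest one, which by the assumption \<open>IH\<close>
  is no larger than the boundary of the slice it replaces. Hence the boundary does not grow, and
  optimality forces all slices to be initial segments.\<close>

lemma optimal_slices:
  assumes opt: "optimal K S A" and S: "S \<subseteq> {..<K}" and "i \<in> S"
    and IH: "\<And>B. B \<subseteq> grid (S - {i}) \<Longrightarrow> finite B \<Longrightarrow>
       \<exists>J. initial K (S - {i}) J \<and> finite J \<and> card J = card B \<and> card (bdry (S - {i}) J) \<le> card (bdry (S - {i}) B)"
    and u: "u \<in> A" and v: "v \<in> grid S" "v i = u i" "wt K S v < wt K S u"
  shows "v \<in> A"
proof -
  let ?S = "S - {i}"
  have A: "A \<subseteq> grid S" "finite A" using opt by (auto simp: optimal_def)
  have finS: "finite S" using S finite_subset by blast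
  have S': "?S \<subseteq> {..<K}" using S by auto
  have finsl: "finite (slice i t B)" if "finite B" for t B
  proof (rule inj_on_finite[of "\<lambda>v. v(i := t)" _ B])
    show "inj_on (\<lambda>v. v(i := t)) (slice i t B)"
      by (auto simp: inj_on_def slice_def fun_eq_iff) metis
  qed (use that in \<open>auto simp: slice_def\<close>)
  have slgrid: "slice i t A \<subseteq> grid ?S" for t
  proof
    fix v assume v: "v \<in> slice i t A"
    then have "(v(i := t))(i := 0) \<in> grid ?S" using A unfolding slice_def by (intro grid_delete) auto
    then show "v \<in> grid ?S" using v by (simp add: slice_def fun_upd_idem)
  qed
  obtain J where J: "\<And>t. initial K ?S (J t)" "\<And>t. finite (J t)" "\<And>t. card (J t) = card (slice i t A)"
      "\<And>t. card (bdry ?S (J t)) \<le> card (bdry ?S (slice i t A))"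
    using IH[OF slgrid finsl[OF A(2)]] by metis
  have Jgrid: "J t \<subseteq> grid ?S" for t using J(1) by (simp add: initial_def)
  define B where "B = {u. u(i := 0) \<in> J (u i)}"
  define T where "T = (\<lambda>u. u i) ` A"
  have finT: "finite T" using A by (simp add: T_def)
  have slB: "slice i t B = J t" for t
    using Jgrid[of t] by (auto simp: slice_def B_def grid_def fun_upd_idem)
  have Jempty: "t \<in> T" if "J t \<noteq> {}" for t
  proof -
    have "slice i t A \<noteq> {}" using that J(2,3) by (metis card_eq_0_iff card.empty)
    then obtain v where "v(i := t) \<in> A" by (auto simp: slice_def)
    then show ?thesis unfolding T_def by (rule rev_image_eqI) simp
  qed
  have Bgrid: "B \<subseteq> grid S"
  proof
    fix u assume "u \<in> B"
    then have "u(i := 0) \<in> grid ?S" using Jgrid by (auto simp: B_def)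
    from grid_insert[OF this assms(3), of "u i"] show "u \<in> grid S" by simp
  qed
  have BT: "(\<lambda>u. u i) ` B \<subseteq> T" using Jempty by (auto simp: B_def)
  have finB: "finite B"
  proof (rule finite_subset)
    show "B \<subseteq> (\<lambda>(t,v). v(i := t)) ` (SIGMA t:T. J t)"
    proof
      fix u assume u: "u \<in> B"
      then have "(u i, u(i := 0)) \<in> (SIGMA t:T. J t)" using BT by (auto simp: B_def)
      then show "u \<in> (\<lambda>(t,v). v(i := t)) ` (SIGMA t:T. J t)"
        by (rule rev_image_eqI) simp
    qed
  qed (use finT J in auto)
  have cardB: "card B = card A"
    using sum_slices[OF finB finT BT, of "\<lambda>_. 1"] sum_slices[OF A(2) finT, of i "\<lambda>_. 1"]
    by (simp add: slB J(3) T_def)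
  have bdry_slice: "slice i s (bdry S C) = (\<Union>t\<in>{t. near s t}. bdry ?S (slice i t C))" if "C \<subseteq> grid S" for s C
  proof (intro set_eqI iffI)
    fix p assume p: "p \<in> slice i s (bdry S C)"
    then have p0: "p i = 0" and pg: "p(i := s) \<in> grid S" by (auto simp: slice_def bdry_def)
    have pg': "p \<in> grid ?S" using grid_delete[OF pg, of i] p0 by (simp add: fun_upd_idem)
    obtain a where a: "a \<in> C" "near s (a i)" "\<forall>j\<in>?S. near (p j) (a j)"
      using p upd_mem_bdry_iff[OF assms(3) pg'] unfolding slice_def by blast
    have "a(i := 0) \<in> slice i (a i) C" using a by (simp add: slice_def)
    moreover have "\<forall>j\<in>?S. near (p j) ((a(i := 0)) j)" using a(3) by auto
    ultimately show "p \<in> (\<Union>t\<in>{t. near s t}. bdry ?S (slice i t C))"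
      using pg' a(2) unfolding bdry_def by blast
  next
    fix p assume "p \<in> (\<Union>t\<in>{t. near s t}. bdry ?S (slice i t C))"
    then obtain t a where t: "near s t" "p \<in> grid ?S" "a(i := t) \<in> C" "\<forall>j\<in>?S. near (p j) (a j)"
      by (auto simp: bdry_def slice_def)
    have "near s ((a(i := t)) i) \<and> (\<forall>j\<in>?S. near (p j) ((a(i := t)) j))" using t by auto
    then have "p(i := s) \<in> bdry S C" using upd_mem_bdry_iff[OF assms(3) t(2)] t(3) by blast
    moreover have "p i = 0" using t(2) by (simp add: grid_def)
    ultimately show "p \<in> slice i s (bdry S C)" unfolding slice_def by blast
  qed
  have slice_le: "card (slice i s (bdry S B)) \<le> card (slice i s (bdry S A))" for s
  proof -
    define R where "R = {t \<in> T. near s t}"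
    have eq: "slice i s (bdry S B) = (\<Union>t\<in>R. bdry ?S (J t))"
      unfolding bdry_slice[OF Bgrid] slB using Jempty by (auto simp: R_def bdry_def)
    show ?thesis
    proof (cases "R = {}")
      case False
      have finR: "finite R" using finT by (simp add: R_def)
      obtain m where m: "m \<in> R" "\<And>t. t \<in> R \<Longrightarrow> card (J t) \<le> card (J m)"
      proof -
        have "Max ((\<lambda>t. card (J t)) ` R) \<in> (\<lambda>t. card (J t)) ` R"
          using finR False by (intro Max_in) auto
        then obtain m where "m \<in> R" "Max ((\<lambda>t. card (J t)) ` R) = card (J m)" by blast
        then show ?thesis
          using that[of m] Max_ge[of "(\<lambda>t. card (J t)) ` R"] finR by (metis finite_imageI imageI)
      qed
      have "J t \<subseteq> J m" if "t \<in> R" for t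
        using initial_subset_if_card_le[OF S' J(1) J(1) J(2)] m that by blast
      then have "slice i s (bdry S B) \<subseteq> bdry ?S (J m)" unfolding eq using bdry_mono by blast
      then have "card (slice i s (bdry S B)) \<le> card (bdry ?S (J m))"
        using finS J(2) by (intro card_mono finite_bdry) auto
      also have "\<dots> \<le> card (bdry ?S (slice i m A))" by (rule J)
      also have "\<dots> \<le> card (slice i s (bdry S A))"
      proof (rule card_mono)
        show "finite (slice i s (bdry S A))" using finsl finite_bdry finS A by blast
        show "bdry ?S (slice i m A) \<subseteq> slice i s (bdry S A)"
          unfolding bdry_slice[OF A(1)] using m(1) by (auto simp: R_def)
      qed
      finally show ?thesis .
    qed (simp add: eq)
  qed
  define T' where "T' = (\<lambda>u. u i) ` (bdry S A \<union> bdry S B)"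
  have finT': "finite T'" using finite_bdry finS A finB by (simp add: T'_def)
  have "card (bdry S C) = (\<Sum>t\<in>T'. card (slice i t (bdry S C)))" if "C \<in> {A, B}" for C
    using sum_slices[OF _ finT', of "bdry S C" i "\<lambda>_. 1"] finite_bdry[OF finS] A(2) finB that
    by (auto simp: T'_def)
  then have "card (bdry S B) \<le> card (bdry S A)" using slice_le by (simp add: sum_mono)
  then have opt_le: "sum (wt K S) A \<le> sum (wt K S) B"
    using opt Bgrid finB cardB by (auto simp: optimal_def)
  have sl_wt: "sum (wt K S) C = (\<Sum>t\<in>T. card (slice i t C) * 2 ^ place K i t + sum (wt K ?S) (slice i t C))"
    if "finite C" "(\<lambda>u. u i) ` C \<subseteq> T" for C
    using sum_slices[OF that(1) finT that(2), of "wt K S"]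
    by (simp add: wt_upd[OF finS assms(3)] sum.distrib)
  have less: "sum (wt K ?S) (J t) < sum (wt K ?S) (slice i t A)" if "J t \<noteq> slice i t A" for t
  proof (rule sum_less_exchange)
    fix x y assume "x \<in> J t - slice i t A" "y \<in> slice i t A - J t"
    then have "\<not> wt K ?S y < wt K ?S x" "x \<noteq> y" "x \<in> grid ?S" "y \<in> grid ?S"
      using J(1)[of t] slgrid[of t] by (auto simp: initial_def)
    then show "wt K ?S x < wt K ?S y" using wt_inj[OF S', of x y] by fastforce
  qed (use J finsl A that in auto)
  have "J t = slice i t A" if "t \<in> T" for t
  proof (rule ccontr)
    assume ne: "J t \<noteq> slice i t A"
    have "sum (wt K S) B < sum (wt K S) A"
      unfolding sl_wt[OF finB BT] sl_wt[OF A(2) T_def[symmetric, THEN equalityD1]] slB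
    proof (rule sum_strict_mono_ex1[OF finT])
      show "\<forall>t\<in>T. card (J t) * 2 ^ place K i t + sum (wt K ?S) (J t)
          \<le> card (slice i t A) * 2 ^ place K i t + sum (wt K ?S) (slice i t A)"
        using less J(3) by (metis add_left_mono less_imp_le order_refl)
      show "\<exists>t\<in>T. card (J t) * 2 ^ place K i t + sum (wt K ?S) (J t)
          < card (slice i t A) * 2 ^ place K i t + sum (wt K ?S) (slice i t A)"
        using less[OF ne] J(3) that by auto
    qed
    then show False using opt_le by simp
  qed
  moreover have "u i \<in> T" using u by (simp add: T_def)
  ultimately have eq: "slice i (u i) A = J (u i)" by simp
  have split: "wt K S x = 2 ^ place K i (x i) + wt K ?S (x(i := 0))" for x
    using wt_upd[OF finS assms(3), of K "x(i := 0)" "x i"] by simp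
  have "wt K ?S (v(i := 0)) < wt K ?S (u(i := 0))"
    using v(2,3) split[of u] split[of v] by simp
  moreover have "u(i := 0) \<in> slice i (u i) A" using u by (simp add: slice_def)
  ultimately have "v(i := 0) \<in> slice i (u i) A"
    using J(1)[of "u i"] grid_delete[OF v(1)] unfolding eq initial_def by blast
  then have "v(i := 0) \<in> slice i (v i) A" using v(2) by simp
  then show ?thesis by (simp add: slice_def)
qed

lemma optimal_downset:
  assumes opt: "optimal K S A" and S: "S \<subseteq> {..<K}" and "u \<in> A" "v \<le> u"
  shows "v \<in> A"
proof -
  have finS: "finite S" using S finite_subset by blast
  have A: "A \<subseteq> grid S" using opt by (simp add: optimal_def)
  have "F \<subseteq> S \<Longrightarrow> (\<lambda>i. if i \<in> F then v i else u i) \<in> A" if "finite F" for F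
    using that
  proof induction
    case (insert j F)
    let ?w = "\<lambda>i. if i \<in> F then v i else u i"
    have "?w(j := v j) \<in> A"
      using insert assms(4) by (intro optimal_columns[OF opt S]) (auto simp: le_fun_def)
    moreover have "?w(j := v j) = (\<lambda>i. if i \<in> insert j F then v i else u i)" by auto
    ultimately show ?case by simp
  qed (use assms in simp)
  from this[OF finS order_refl] have "(\<lambda>i. if i \<in> S then v i else u i) \<in> A" .
  moreover have "(\<lambda>i. if i \<in> S then v i else u i) = v"
    using A assms(3) grid_le[OF _ assms(4), of S] by (auto simp: grid_def fun_eq_iff subset_iff)
  ultimately show ?thesis by simp
qed

section \<open>Boundaries of down-closed sets\<close>

definition down_closed :: "(nat \<Rightarrow> nat) set \<Rightarrow> bool" where
  "down_closed A \<longleftrightarrow> (\<forall>u\<in>A. \<forall>v\<le>u. v \<in> A)"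

text \<open>Truncated subtraction of \<open>2\<close> takes the value \<open>0\<close> three times and every other value once.\<close>

lemma card_fibre:
  assumes "finite S" "u \<in> grid S"
  shows "card {p \<in> grid S. (\<lambda>i. p i - 2) = u} = 3 ^ card {i \<in> S. u i = 0}"
proof -
  have "card {p \<in> grid S. (\<lambda>i. p i - 2) = u} = card (\<Pi>\<^sub>E i\<in>S. {m. m - 2 = u i})"
  proof (rule bij_betw_same_card)
    show "bij_betw (\<lambda>p. restrict p S) {p \<in> grid S. (\<lambda>i. p i - 2) = u} (\<Pi>\<^sub>E i\<in>S. {m. m - 2 = u i})"
      by (rule bij_betw_byWitness[where f' = "\<lambda>f i. if i \<in> S then f i else 0"])
        (use assms(2) in \<open>auto simp: grid_def fun_eq_iff PiE_iff extensional_def\<close>)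
  qed
  also have "\<dots> = (\<Prod>i\<in>S. card {m. m - 2 = u i})" using assms by (simp add: card_PiE)
  also have "\<dots> = (\<Prod>i\<in>S. if u i = 0 then 3 else 1)"
  proof (rule prod.cong)
    fix i
    have "{m::nat. m - 2 = u i} = (if u i = 0 then {0, 1, 2} else {u i + 2})" by auto
    then show "card {m. m - 2 = u i} = (if u i = 0 then 3 else 1)" by simp
  qed simp
  also have "\<dots> = 3 ^ card {i \<in> S. u i = 0}"
    using assms(1) by (simp add: prod.inter_filter[symmetric])
  finally show ?thesis .
qed

lemma card_bdry_down_closed:
  assumes "finite S" "A \<subseteq> grid S" "finite A" "down_closed A"
  shows "card (bdry S A) = (\<Sum>u\<in>A. 3 ^ card {i \<in> S. u i = 0})"
proof -
  let ?F = "\<lambda>u. {p \<in> grid S. (\<lambda>i. p i - 2) = u}"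
  have "bdry S A = (\<Union>u\<in>A. ?F u)"
  proof (intro set_eqI iffI)
    fix p assume "p \<in> bdry S A"
    then obtain a where a: "p \<in> grid S" "a \<in> A" "\<forall>i\<in>S. near (p i) (a i)" by (auto simp: bdry_def)
    have "p i - 2 \<le> a i" for i
    proof (cases "i \<in> S")
      case True
      then show ?thesis using near_le[of "p i" "a i"] a(3) by auto
    qed (use a(1) in \<open>simp add: grid_def\<close>)
    then have "(\<lambda>i. p i - 2) \<in> A" using a(2) assms(4) by (auto simp: down_closed_def le_fun_def)
    then show "p \<in> (\<Union>u\<in>A. ?F u)" using a(1) by blast
  next
    fix p assume "p \<in> (\<Union>u\<in>A. ?F u)"
    then have "p \<in> grid S" "(\<lambda>i. p i - 2) \<in> A" by auto
    then show "p \<in> bdry S A"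
      unfolding bdry_def using near_minus_2 by (auto intro: bexI[of _ "\<lambda>i. p i - 2"])
  qed
  moreover have card: "card (?F u) = 3 ^ card {i \<in> S. u i = 0}" if "u \<in> A" for u
    using card_fibre[OF assms(1)] assms(2) that by blast
  moreover have "finite (?F u)" if "u \<in> A" for u
    using card[OF that] by (intro card_ge_0_finite) simp
  then have "card (\<Union>u\<in>A. ?F u) = (\<Sum>u\<in>A. card (?F u))"
    using assms(3) by (intro card_UN_disjoint) auto
  ultimately show ?thesis by simp
qed

section \<open>Optimal sets are initial segments\<close>

text \<open>By the weighted count, trading points for points with no more zeros does not enlarge the
  boundary if the set stays down-closed; an optimal set then leaves no lighter trade.\<close>

lemma optimal_no_exchange:
  assumes opt: "optimal K S A" and S: "finite S" and dA: "down_closed A"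
    and L: "L \<subseteq> A" "L \<noteq> {}" and f: "inj_on f L" "f ` L \<subseteq> grid S" "f ` L \<inter> A = {}"
    and zeros: "\<And>u. u \<in> L \<Longrightarrow> card {i \<in> S. f u i = 0} \<le> card {i \<in> S. u i = 0}"
    and less: "\<And>u. u \<in> L \<Longrightarrow> wt K S (f u) < wt K S u"
    and dB: "down_closed (A - L \<union> f ` L)"
  shows False
proof -
  let ?B = "A - L \<union> f ` L"
  have A: "A \<subseteq> grid S" "finite A" using opt by (auto simp: optimal_def)
  have finL: "finite L" using A L finite_subset by blast
  have sumA: "sum g A = sum g (A - L) + sum g L" for g :: "_ \<Rightarrow> nat"
    using A(2) L(1) by (metis sum.subset_diff)
  have sumB: "sum g ?B = sum g (A - L) + (\<Sum>u\<in>L. g (f u))" for g :: "_ \<Rightarrow> nat"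
    using A(2) finL f by (subst sum.union_disjoint) (auto simp: sum.reindex)
  have B: "?B \<subseteq> grid S" "finite ?B" using A f finL by auto
  have "card ?B = card A" using sumA[of "\<lambda>_. 1"] sumB[of "\<lambda>_. 1"] by simp
  moreover have "card (bdry S ?B) \<le> card (bdry S A)"
    unfolding card_bdry_down_closed[OF S B dB] card_bdry_down_closed[OF S A dA] sumA sumB
    using zeros by (intro add_left_mono sum_mono power_increasing) auto
  ultimately have "sum (wt K S) A \<le> sum (wt K S) ?B"
    using opt B unfolding optimal_def by blast
  moreover have "(\<Sum>u\<in>L. wt K S (f u)) < sum (wt K S) L"
    using less L finL by (intro sum_strict_mono) auto
  ultimately show False unfolding sumA sumB by simp
qed

text \<open>If \<open>y\<close> precedes \<open>x\<close> without sharing the largest pair of \<open>x\<close>, then already that single pair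
  outweighs all of \<open>y\<close>.\<close>

lemma place_less_top:
  assumes S: "S \<subseteq> {..<K}" and "c \<in> S" and top: "\<And>i. i \<in> S \<Longrightarrow> place K i (x i) \<le> place K c (x c)"
    and "wt K S y < wt K S x" "y c \<noteq> x c" "i \<in> S"
  shows "place K i (y i) < place K c (x c)"
proof -
  have finS: "finite S" using S finite_subset by blast
  have "2 ^ place K i (y i) \<le> wt K S y" using finS assms(6) by (rule place_power_le_wt)
  also have "\<dots> < wt K S x" by fact
  also have "\<dots> < 2 ^ Suc (place K c (x c))" using S top by (intro wt_less_power) (auto simp: less_Suc_eq_le)
  finally have "place K i (y i) \<le> place K c (x c)" by (simp add: less_Suc_eq_le del: power_Suc)
  moreover have "place K i (y i) \<noteq> place K c (x c)"
    using place_eq_iff[of i K c "y i" "x c"] S assms(2,5,6) by (metis lessThan_iff subsetD)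
  ultimately show ?thesis by simp
qed

text \<open>Only coordinate \<open>c\<close> of \<open>v\<close> may exceed that of \<open>u\<close>; it is outweighed because the pair
  \<open>(u j, j)\<close> has a larger number than both \<open>(v c, c)\<close> and \<open>(v j, j)\<close>.\<close>

lemma wt_less_if_dominated:
  assumes S: "S \<subseteq> {..<K}" and "c \<in> S" "j \<in> S" "j \<noteq> c"
    and le: "\<And>i. i \<in> S \<Longrightarrow> i \<noteq> c \<Longrightarrow> v i \<le> u i"
    and "v j < u j" "place K c (v c) < place K j (u j)"
  shows "wt K S v < wt K S u"
proof -
  have finS: "finite S" using S finite_subset by blast
  have split: "wt K S x = 2 ^ place K c (x c) + (2 ^ place K j (x j) + wt K (S - {c} - {j}) x)" for x
    unfolding wt_def using finS assms(2-4) by (simp add: sum.remove[of S c] sum.remove[of "S - {c}" j])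
  have "j < K" using S assms(3) by auto
  then have "place K j (v j) < place K j (u j)" using assms(6) by (rule place_strict_mono)
  then have "(2::nat) ^ Suc (place K j (v j)) \<le> 2 ^ place K j (u j)"
       "(2::nat) ^ Suc (place K c (v c)) \<le> 2 ^ place K j (u j)"
    using assms(7) by (intro power_increasing; simp)+
  moreover have "wt K (S - {c} - {j}) v \<le> wt K (S - {c} - {j}) u"
    unfolding wt_def using le by (intro sum_mono power_increasing place_mono) auto
  moreover have "(0::nat) < 2 ^ place K c (u c)" by simp
  ultimately show ?thesis unfolding split power_Suc by linarith
qed

text \<open>The exchange argument: first a single point is traded, which leaves a very rigid
  configuration, and then a line.\<close>

lemma optimal_initial:
  assumes opt: "optimal K S A" and S: "S \<subseteq> {..<K}"
    and slices: "\<And>i u v. i \<in> S \<Longrightarrow> u \<in> A \<Longrightarrow> v \<in> grid S \<Longrightarrow> v i = u i \<Longrightarrow> wt K S v < wt K S u \<Longrightarrow> v \<in> A"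
  shows "initial K S A"
proof (rule ccontr)
  assume not_init: "\<not> initial K S A"
  have finS: "finite S" using S finite_subset by blast
  have A: "A \<subseteq> grid S" "finite A" using opt by (auto simp: optimal_def)
  have down: "v \<in> A" if "u \<in> A" "v \<le> u" for u v using optimal_downset[OF opt S that] .
  then have dA: "down_closed A" by (auto simp: down_closed_def)
  obtain a b where ab: "a \<in> A" "b \<in> grid S" "b \<notin> A" "wt K S b < wt K S a"
    using not_init A by (auto simp: initial_def)
  obtain y where y: "y \<in> grid S" "y \<notin> A" and y_min: "\<And>v. v \<in> grid S \<Longrightarrow> v \<notin> A \<Longrightarrow> wt K S y \<le> wt K S v"
    using ex_has_least_nat[of "\<lambda>v. v \<in> grid S \<and> v \<notin> A" b "wt K S"] ab by blast
  obtain x where x: "x \<in> A" and x_max: "\<And>v. v \<in> A \<Longrightarrow> wt K S v \<le> wt K S x"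
  proof -
    have "Max (wt K S ` A) \<in> wt K S ` A" using A(2) ab(1) by (intro Max_in) auto
    then obtain x where "x \<in> A" "Max (wt K S ` A) = wt K S x" by blast
    then show thesis using that[of x] Max_ge[of "wt K S ` A"] A(2) by (metis finite_imageI imageI)
  qed
  have yx: "wt K S y < wt K S x" using y_min[OF ab(2,3)] x_max[OF ab(1)] ab(4) by simp
  have xg: "x \<in> grid S" using x A by blast
  have below_y: "v \<in> A" if "v \<le> y" "v \<noteq> y" for v
    using wt_strict_mono[OF S y(1) that] y_min grid_le[OF y(1) that(1)] by fastforce
  have above_x: "v = x" if "v \<in> A" "x \<le> v" for v
    using wt_strict_mono[OF S _ that(2)] x_max[OF that(1)] A that by fastforce
  \<comment> \<open>Otherwise \<open>x\<close> could be traded for \<open>y\<close>.\<close>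
  have zeros: "card {i \<in> S. x i = 0} < card {i \<in> S. y i = 0}"
  proof (rule ccontr)
    assume "\<not> ?thesis"
    moreover have "down_closed (A - {x} \<union> {y})"
      unfolding down_closed_def
    proof (intro ballI allI impI)
      fix u v assume u: "u \<in> A - {x} \<union> {y}" and v: "v \<le> u"
      show "v \<in> A - {x} \<union> {y}"
      proof (cases "u = y")
        case True
        have "x \<noteq> v" using True v yx wt_mono[of v y K S] by auto
        then show ?thesis using below_y[of v] True v by blast
      next
        case False
        then have "u \<in> A" "u \<noteq> x" using u by auto
        then show ?thesis using above_x[of u] down v by blast
      qed
    qed
    ultimately show False
      using optimal_no_exchange[OF opt finS dA, of "{x}" "\<lambda>_. y"] x y yx by auto
  qed
  have disj: "y j \<noteq> x j" if "j \<in> S" for j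
    using slices[OF that x y(1)] y(2) yx by auto
  have "S \<noteq> {}" using yx by (auto simp: wt_def)
  obtain c where c: "c \<in> S" and c_max: "\<And>i. i \<in> S \<Longrightarrow> place K i (x i) \<le> place K c (x c)"
  proof -
    have "Max ((\<lambda>i. place K i (x i)) ` S) \<in> (\<lambda>i. place K i (x i)) ` S"
      using finS \<open>S \<noteq> {}\<close> by (intro Max_in) auto
    then obtain c where "c \<in> S" "Max ((\<lambda>i. place K i (x i)) ` S) = place K c (x c)" by blast
    then show thesis
      using that[of c] Max_ge[of "(\<lambda>i. place K i (x i)) ` S"] finS by (metis finite_imageI imageI)
  qed
  have cK: "c < K" using c S by auto
  have y_top: "place K i (y i) < place K c (x c)" if "i \<in> S" for i
    using place_less_top[OF S c c_max yx disj[OF c] that] by simp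
  \<comment> \<open>If \<open>y j < x j\<close>, then \<open>x(j := y j)\<close> lies between \<open>y\<close> and \<open>x\<close> and shares a coordinate
      with each of them, so membership passes from \<open>x\<close> to \<open>y\<close> through two slices.\<close>
  have y_gt: "x j < y j" if j: "j \<in> S" "j \<noteq> c" for j
  proof (rule ccontr)
    assume "\<not> x j < y j"
    then have less: "y j < x j" using disj[OF j(1)] by simp
    let ?z = "x(j := y j)"
    have "?z \<in> A" using less by (intro down[OF x]) (simp add: le_fun_def)
    moreover have "wt K S y < 2 ^ place K c (x c)" using S y_top by (rule wt_less_power)
    then have "wt K S y < wt K S ?z" using place_power_le_wt[OF finS c, of K ?z] j(2) by simp
    ultimately have "y \<in> A" using slices[OF j(1), of ?z y] y(1) by simp
    then show False using y(2) by simp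
  qed
  have "{i \<in> S. y i = 0} \<subseteq> {c}" using y_gt by fastforce
  then have "{i \<in> S. y i = 0} = {} \<or> {i \<in> S. y i = 0} = {c}" by (rule subset_singletonD)
  moreover have "{i \<in> S. y i = 0} \<noteq> {}"
  proof
    assume "{i \<in> S. y i = 0} = {}"
    then show False using zeros by (simp only: card.empty not_less_zero)
  qed
  ultimately have y_zeros: "{i \<in> S. y i = 0} = {c}" by meson
  then have yc: "y c = 0" by blast
  have x0: "card {i \<in> S. x i = 0} = 0" using zeros by (simp add: y_zeros)
  have x_pos: "x i > 0" if "i \<in> S" for i using x0 finS that by auto
  obtain q where q: "q \<in> S" "q \<noteq> c" and q_min: "\<And>i. i \<in> S - {c} \<Longrightarrow> place K q (x q) \<le> place K i (x i)"
  proof -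
    have "S - {c} \<noteq> {}"
    proof
      assume "S - {c} = {}"
      then have "y i = 0" for i using y(1) yc by (cases "i = c") (auto simp: grid_def)
      then have "y \<le> x" by (simp add: le_fun_def)
      then show False using down[OF x] y(2) by blast
    qed
    then have "Min ((\<lambda>i. place K i (x i)) ` (S - {c})) \<in> (\<lambda>i. place K i (x i)) ` (S - {c})"
      using finS by (intro Min_in) auto
    then obtain q where q: "q \<in> S - {c}"
      "Min ((\<lambda>i. place K i (x i)) ` (S - {c})) = place K q (x q)" by blast
    have "place K q (x q) \<le> place K i (x i)" if "i \<in> S - {c}" for i
      unfolding q(2)[symmetric] using that finS by (intro Min_le) auto
    then show thesis using that[of q] q(1) by blast
  qed
  have place_D: "s \<le> t" if "place K i s \<le> place K j t" "i \<in> S" "j \<in> S" for i j s t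
    using that place_less_iff[of j K i t s] S by (metis lessThan_iff not_le subsetD)
  have q_le: "x q \<le> x i" if "i \<in> S" "i \<noteq> c" for i
    using place_D[OF q_min q(1)] that by blast
  have xq_xc: "x q < x c"
    using y_gt[OF q] place_D[OF less_imp_le[OF y_top] q(1) c] q(1) by fastforce
  \<comment> \<open>The line \<open>L\<close> below \<open>x\<close> is traded for the line above \<open>y\<close>, a point with \<open>q\<close>-coordinate
      \<open>a\<close> for the point with \<open>c\<close>-coordinate \<open>a\<close>.\<close>
  define L where "L = (\<lambda>a. x(q := a)) ` {..x q}"
  define f where "f u = y(c := u q)" for u :: "nat \<Rightarrow> nat"
  have L_iff: "u \<in> L \<longleftrightarrow> u q \<le> x q \<and> (\<forall>i. i \<noteq> q \<longrightarrow> u i = x i)" for u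
    by (auto simp: L_def image_iff fun_eq_iff)
  have fL: "f ` L = (\<lambda>a. y(c := a)) ` {..x q}"
    by (auto simp: L_def f_def image_image)
  \<comment> \<open>Removing \<open>L\<close> keeps the set down-closed: as \<open>(x q, q)\<close> is the smallest pair of \<open>x\<close>, whatever lies
      above \<open>L\<close> but outside \<open>L\<close> comes after \<open>x\<close>, however small its \<open>q\<close>-coordinate.\<close>
  have L_max: False if "u \<in> A" "v \<in> L" "v \<le> u" "u \<notin> L" for u v
  proof -
    have ug: "u \<in> grid S" using that A by blast
    have ge: "x i \<le> u i" if "i \<noteq> q" for i
      using \<open>v \<in> L\<close> \<open>v \<le> u\<close> that by (metis L_iff le_fun_def)
    have "wt K S x < wt K S u"
    proof (cases "\<exists>j. j \<noteq> q \<and> x j < u j")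
      case True
      then obtain j where j: "j \<noteq> q" "x j < u j" by blast
      then have jS: "j \<in> S" using ug by (auto simp: grid_def)
      have "place K q (x q) \<le> place K j (x j)"
        using q_min[of j] c_max[OF q(1)] jS by (cases "j = c") auto
      also have "\<dots> < place K j (u j)" using j jS S by (intro place_strict_mono) auto
      finally show ?thesis using ge j jS q(1) by (intro wt_less_if_dominated[OF S q(1) jS]) auto
    next
      case False
      then have eq: "u i = x i" if "i \<noteq> q" for i using ge[OF that] that by (metis le_neq_implies_less)
      then have "x q < u q" using \<open>u \<notin> L\<close> L_iff[of u] by auto
      then have "x \<le> u" "x \<noteq> u" using eq by (auto simp: le_fun_def) (metis eq_imp_le less_imp_le)
      then show ?thesis using wt_strict_mono[OF S ug] by blast
    qed
    then show False using x_max[OF that(1)] by simp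
  qed
  \<comment> \<open>Adding the new line keeps it down-closed: decreasing some \<open>y j\<close> with \<open>j \<noteq> c\<close> leads before \<open>y\<close>, even if
      the \<open>c\<close>-coordinate has grown to \<open>a \<le> x q \<le> x j < y j\<close>.\<close>
  have fL_below: "v \<in> A - L \<union> f ` L" if "u \<in> f ` L" "v \<le> u" for u v
  proof -
    obtain a where a: "a \<le> x q" "u = y(c := a)" using \<open>u \<in> f ` L\<close> fL by auto
    have v_le_upd: "v i \<le> (y(c := a)) i" for i
      using \<open>v \<le> u\<close> unfolding a(2) by (rule le_funD)
    have vc: "v c \<le> a" using v_le_upd[of c] by simp
    have v_le: "v i \<le> y i" if "i \<noteq> c" for i using v_le_upd[of i] that by simp
    show ?thesis
    proof (cases "\<forall>i. i \<noteq> c \<longrightarrow> v i = y i")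
      case True
      then have "v = y(c := v c)" by auto
      moreover have "v c \<in> {..x q}" using vc a(1) by simp
      ultimately have "v \<in> f ` L" unfolding fL by (rule image_eqI)
      then show ?thesis ..
    next
      case False
      then obtain j where j: "j \<noteq> c" "v j < y j" using v_le by (metis le_neq_implies_less)
      then have jS: "j \<in> S" using y(1) by (auto simp: grid_def)
      have "v c < y j" using vc a(1) q_le[OF jS j(1)] y_gt[OF jS j(1)] by simp
      then have "place K c (v c) < place K j (y j)"
        using cK jS S by (auto simp: place_less_iff)
      then have "wt K S v < wt K S y"
        using j jS c v_le by (intro wt_less_if_dominated[OF S c jS]) auto
      moreover have "v \<in> grid S" using \<open>v \<le> u\<close> a(2) grid_le grid_upd[OF y(1) c] by blast
      ultimately have "v \<in> A" using y_min by (meson leD)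
      moreover have "v c \<noteq> x c" using vc a(1) xq_xc by simp
      then have "v \<notin> L" using L_iff[of v] q(2) by auto
      ultimately show ?thesis by blast
    qed
  qed
  show False
  proof (rule optimal_no_exchange[OF opt finS dA, of L f])
    show "L \<subseteq> A" using down[OF x] by (auto simp: L_def le_fun_def)
    show "L \<noteq> {}" by (simp add: L_def)
    show "inj_on f L" by (auto simp: inj_on_def f_def L_def dest: fun_cong[where x = c])
    show "f ` L \<subseteq> grid S" unfolding fL using grid_upd[OF y(1) c] by auto
    show "f ` L \<inter> A = {}"
    proof -
      have "y \<le> y(c := a)" for a using yc by (simp add: le_fun_def)
      then show ?thesis unfolding fL using down y(2) by blast
    qed
    show "down_closed (A - L \<union> f ` L)"
      unfolding down_closed_def using fL_below L_max down by blast
  next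
    fix u assume u: "u \<in> L"
    have "i = c" if "i \<in> S" "y i = 0" for i using y_gt[OF that(1)] that(2) by (cases "i = c") auto
    then have "{i \<in> S. f u i = 0} = (if u q = 0 then {c} else {})"
      using c by (auto simp: f_def split: if_splits)
    moreover have "{i \<in> S. u i = 0} = (if u q = 0 then {q} else {})"
      using u x_pos q by (auto simp: L_iff split: if_splits) (metis less_irrefl)+
    ultimately show "card {i \<in> S. f u i = 0} \<le> card {i \<in> S. u i = 0}" by simp
    have "place K i (f u i) < place K c (x c)" if "i \<in> S" for i
    proof (cases "i = c")
      case True
      have "u q < x c" using u xq_xc by (simp add: L_iff)
      then show ?thesis using True place_strict_mono[OF cK] by (simp add: f_def)
    qed (use y_top[OF that] in \<open>simp add: f_def\<close>)
    then have "wt K S (f u) < 2 ^ place K c (x c)" using S by (intro wt_less_power)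
    also have "\<dots> \<le> wt K S u"
      using place_power_le_wt[OF finS c, of K u] u q(2) by (simp add: L_iff)
    finally show "wt K S (f u) < wt K S u" .
  qed
qed

text \<open>Stating existence provides the initial segments of prescribed size that
  \<open>optimal_slices\<close> asks for in the induction step.\<close>

theorem initial_exists_bdry_le:
  assumes "S \<subseteq> {..<K}" "A \<subseteq> grid S" "finite A"
  shows "\<exists>J. initial K S J \<and> finite J \<and> card J = card A \<and> card (bdry S J) \<le> card (bdry S A)"
  using assms
proof (induction "card S" arbitrary: S A rule: less_induct)
  case less
  have finS: "finite S" using less.prems finite_subset by blast
  obtain B where B: "optimal K S B" "card B = card A" "card (bdry S B) \<le> card (bdry S A)"
    using optimal_exists[OF less.prems(2,3)] by blast
  have "initial K S B"
  proof (rule optimal_initial[OF B(1) less.prems(1)])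
    fix i u v assume i: "i \<in> S" and uv: "u \<in> B" "v \<in> grid S" "v i = u i" "wt K S v < wt K S u"
    have "card (S - {i}) < card S" using finS i by (rule card_Diff1_less)
    moreover have "S - {i} \<subseteq> {..<K}" using less.prems(1) by auto
    ultimately have IH: "\<exists>J. initial K (S - {i}) J \<and> finite J \<and> card J = card B
        \<and> card (bdry (S - {i}) J) \<le> card (bdry (S - {i}) B)"
      if "B \<subseteq> grid (S - {i})" "finite B" for B
      using less.hyps that by blast
    from optimal_slices[OF B(1) less.prems(1) i IH uv] show "v \<in> B" .
  qed
  then show ?case using B by (auto simp: optimal_def)
qed

theorem bdry_initial_le:
  assumes "S \<subseteq> {..<K}" "A \<subseteq> grid S" "finite A" "initial K S J" "finite J" "card J = card A"
  shows "card (bdry S J) \<le> card (bdry S A)"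
proof -
  obtain I where I: "initial K S I" "finite I" "card I = card A" "card (bdry S I) \<le> card (bdry S A)"
    using initial_exists_bdry_le[OF assms(1-3)] by blast
  have "I = J"
    using initial_subset_if_card_le[OF assms(1) I(1) assms(4) I(2)]
      initial_subset_if_card_le[OF assms(1,4) I(1) assms(5)] I(3) assms(6) by auto
  then show ?thesis using I(4) by simp
qed

section \<open>From integer lists to the grid\<close>

definition coords :: "int list \<Rightarrow> nat \<Rightarrow> nat" where
  "coords u = (\<lambda>i. if i < length u then int_pos (u ! i) else 0)"

lemma int_pos_eq_iff [simp]: "int_pos a = int_pos b \<longleftrightarrow> a = b"
  by (metis int_at_int_pos)

lemma bij_betw_coords: "bij_betw coords (Zn k) (grid {..<k})"
  by (rule bij_betw_byWitness[where f' = "\<lambda>f. map (\<lambda>i. int_at (f i)) [0..<k]"])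
    (auto simp: Zn_def coords_def grid_def intro!: nth_equalityI)

lemma coords_vertex_boundary:
  assumes "k \<ge> 1" "A \<subseteq> Zn k"
  shows "coords ` vertex_boundary k A = bdry {..<k} (coords ` A)"
proof -
  have near: "linf_norm (map2 (-) x a) \<le> 1 \<longleftrightarrow> (\<forall>i\<in>{..<k}. near (coords x i) (coords a i))"
    if "x \<in> Zn k" "a \<in> Zn k" for x a
  proof -
    have len: "length x = k" "length a = k" using that by (auto simp: Zn_def)
    have "set (map2 (-) x a) \<noteq> {}" using len assms(1) by (cases x; cases a) auto
    then have "linf_norm (map2 (-) x a) \<le> 1 \<longleftrightarrow> (\<forall>d\<in>set (map2 (-) x a). \<bar>d\<bar> \<le> 1)"
      unfolding linf_norm_def by (subst Max_le_iff) auto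
    also have "\<dots> \<longleftrightarrow> (\<forall>i<k. \<bar>x ! i - a ! i\<bar> \<le> 1)"
      using len by (subst all_set_conv_all_nth) simp
    finally show ?thesis using len by (auto simp: near_def coords_def)
  qed
  have img: "coords ` Zn k = grid {..<k}" using bij_betw_coords by (rule bij_betw_imp_surj_on)
  have "vertex_boundary k A = {x \<in> Zn k. \<exists>a\<in>A. \<forall>i\<in>{..<k}. near (coords x i) (coords a i)}"
    unfolding vertex_boundary_def using near assms(2) by blast
  then show ?thesis unfolding bdry_def img[symmetric] by blast
qed

lemma max_coord:
  assumes "u \<noteq> []"
  shows "max_coord u \<in> set u" "\<And>x. x \<in> set u \<Longrightarrow> int_pos x \<le> int_pos (max_coord u)"
proof -
  have "Max (int_pos ` set u) \<in> int_pos ` set u" using assms by (intro Max_in) auto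
  then obtain m where m: "m \<in> set u" "Max (int_pos ` set u) = int_pos m" by blast
  then have max: "int_pos x \<le> int_pos m" if "x \<in> set u" for x
    using that by (metis List.finite_set Max_ge finite_imageI imageI)
  have "max_coord u = m"
    unfolding max_coord_def
  proof (rule the_equality)
    show "m \<in> set u \<and> (\<forall>x\<in>set u. x = m \<or> int_prec x m)"
      using m max by (auto simp: int_prec_def order.strict_iff_order)
  next
    fix n assume "n \<in> set u \<and> (\<forall>x\<in>set u. x = n \<or> int_prec x n)"
    then show "n = m" using m max by (metis int_prec_def leD)
  qed
  then show "max_coord u \<in> set u" "\<And>x. x \<in> set u \<Longrightarrow> int_pos x \<le> int_pos (max_coord u)"
    using m max by auto
qed

lemma max_index:
  assumes "u \<noteq> []"
  shows "max_index u < length u" "u ! max_index u = max_coord u"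
    "\<And>i. i < max_index u \<Longrightarrow> u ! i \<noteq> max_coord u"
proof -
  obtain i where "i < length u \<and> u ! i = max_coord u"
    using max_coord(1)[OF assms] by (auto simp: in_set_conv_nth)
  from LeastI[of "\<lambda>i. i < length u \<and> u ! i = max_coord u", OF this]
  show "max_index u < length u" "u ! max_index u = max_coord u" by (auto simp: max_index_def)
  then show "u ! i \<noteq> max_coord u" if "i < max_index u" for i
    using that not_less_Least[of i "\<lambda>i. i < length u \<and> u ! i = max_coord u"]
    by (auto simp: max_index_def)
qed

text \<open>Deleting a coordinate from a list shifts the later indices. The increasing map \<open>e\<close> remembers
  the original ones, so the induction over dimensions can keep the numbering \<open>place K\<close> fixed.\<close>

definition list_wt :: "nat \<Rightarrow> (nat \<Rightarrow> nat) \<Rightarrow> int list \<Rightarrow> nat" where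
  "list_wt K e u = (\<Sum>i<length u. 2 ^ place K (e i) (int_pos (u ! i)))"

definition skip :: "nat \<Rightarrow> nat \<Rightarrow> nat" where
  "skip m i = (if i < m then i else Suc i)"

lemma list_wt_delete_coord:
  assumes "m < length u"
  shows "list_wt K e u = 2 ^ place K (e m) (int_pos (u ! m)) + list_wt K (e \<circ> skip m) (delete_coord m u)"
proof -
  have len: "length (delete_coord m u) = length u - 1" using assms by (simp add: delete_coord_def)
  have nth: "delete_coord m u ! i = u ! skip m i" for i
    using assms by (auto simp: delete_coord_def skip_def nth_append)
  have "{..<length u} - {m} = skip m ` {..<length u - 1}"
  proof (intro set_eqI iffI)
    fix i assume i: "i \<in> {..<length u} - {m}"
    then have "i = skip m (if i < m then i else i - 1)" by (auto simp: skip_def)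
    moreover have "(if i < m then i else i - 1) \<in> {..<length u - 1}" using i assms by auto
    ultimately show "i \<in> skip m ` {..<length u - 1}" by (rule image_eqI)
  qed (use assms in \<open>auto simp: skip_def\<close>)
  moreover have "inj_on (skip m) {..<length u - 1}" by (auto simp: inj_on_def skip_def split: if_splits)
  ultimately have "(\<Sum>i\<in>{..<length u} - {m}. 2 ^ place K (e i) (int_pos (u ! i)))
      = list_wt K (e \<circ> skip m) (delete_coord m u)"
    by (simp add: list_wt_def len nth sum.reindex)
  then show ?thesis unfolding list_wt_def using assms by (subst sum.remove[of _ m]) auto
qed

text \<open>The maximal coordinate at its first index is the pair with the largest number, and the
  powers of two belonging to the other pairs add up to less than its own.\<close>

lemma list_wt_bounds:
  fixes u e K
  defines "N \<equiv> place K (e (max_index u)) (int_pos (max_coord u))"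
  assumes "u \<noteq> []" and e: "\<And>i j. i < j \<Longrightarrow> j < length u \<Longrightarrow> e i < e j" "\<And>i. i < length u \<Longrightarrow> e i < K"
  shows "2 ^ N \<le> list_wt K e u" "list_wt K e u < 2 ^ Suc N"
proof -
  note mi = max_index[OF assms(2)]
  show "2 ^ N \<le> list_wt K e u"
    unfolding list_wt_delete_coord[OF mi(1)] N_def mi(2) by simp
  have "place K (e i) (int_pos (u ! i)) \<le> N" if i: "i < length u" for i
  proof (cases "u ! i = max_coord u")
    case True
    then have "i = max_index u \<or> max_index u < i" using mi(3)[of i] by (metis linorder_neqE_nat)
    then show ?thesis
    proof
      assume "max_index u < i"
      then show ?thesis
        unfolding N_def using True i e mi(1) by (auto simp: place_less_iff intro!: less_imp_le)
    qed (simp add: N_def mi(2))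
  next
    case False
    then have "int_pos (u ! i) < int_pos (max_coord u)"
      using max_coord(2)[OF assms(2), of "u ! i"] i by (simp add: le_less)
    then show ?thesis
      unfolding N_def using i e(2) mi(1) by (auto simp: place_less_iff intro!: less_imp_le)
  qed
  moreover have "inj_on (\<lambda>i. place K (e i) (int_pos (u ! i))) {..<length u}"
    using e by (auto simp: inj_on_def place_eq_iff) (metis less_irrefl linorder_neqE_nat)
  ultimately show "list_wt K e u < 2 ^ Suc N"
    unfolding list_wt_def by (intro sum_distinct_powers_less) (auto simp: less_Suc_eq_le)
qed

text \<open>The largest pairs of \<open>u\<close> and \<open>v\<close> decide the comparison unless they agree, in which case they
  cancel and the comparison passes to the lists with that coordinate deleted.\<close>

lemma prec_iff_list_wt_less:
  assumes "k \<ge> 1" "length u = k" "length v = k"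
    and "\<And>i j. i < j \<Longrightarrow> j < k \<Longrightarrow> e i < e j" "\<And>i. i < k \<Longrightarrow> e i < K"
  shows "prec k u v \<longleftrightarrow> list_wt K e u < list_wt K e v"
  using assms
proof (induction k u v arbitrary: e rule: prec.induct)
  case (2 u v)
  then have "list_wt K e w = 2 ^ place K (e 0) (int_pos (w ! 0))" if "w \<in> {u, v}" for w
    using that by (auto simp: list_wt_def)
  moreover have "e 0 < K" using 2 by simp
  ultimately show ?case by (simp add: int_prec_def place_less_iff)
next
  case (3 k u v)
  define m where "m = max_index u"
  have ne: "u \<noteq> []" "v \<noteq> []" using 3 by auto
  let ?tu = "place K (e (max_index u)) (int_pos (max_coord u))"
  let ?tv = "place K (e (max_index v)) (int_pos (max_coord v))"
  have bu: "2 ^ ?tu \<le> list_wt K e u" "list_wt K e u < 2 ^ Suc ?tu"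
    using list_wt_bounds[OF ne(1), of e K] 3 by auto
  have bv: "2 ^ ?tv \<le> list_wt K e v" "list_wt K e v < 2 ^ Suc ?tv"
    using list_wt_bounds[OF ne(2), of e K] 3 by auto
  have idx: "max_index u < Suc (Suc k)" "max_index v < Suc (Suc k)"
    using max_index(1) ne 3 by metis+
  have e_less: "e i < e j \<longleftrightarrow> i < j" if "i < Suc (Suc k)" "j < Suc (Suc k)" for i j
    using 3(5) that by (metis less_asym less_irrefl linorder_neqE_nat)
  have top_less: "place K (e i) s < place K (e j) t \<longleftrightarrow> s < t \<or> s = t \<and> j < i"
    if "i < Suc (Suc k)" "j < Suc (Suc k)" for i j s t
    using that 3(6) by (simp add: place_less_iff e_less)
  consider "?tu < ?tv" | "?tv < ?tu" | "?tu = ?tv" by linarith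
  then show ?case
  proof cases
    case 1
    then have "(2::nat) ^ Suc ?tu \<le> 2 ^ ?tv" by (intro power_increasing) auto
    then have less: "list_wt K e u < list_wt K e v" using bu(2) bv(1) by linarith
    then show ?thesis using 1 idx by (auto simp: top_less int_prec_def)
  next
    case 2
    then have "(2::nat) ^ Suc ?tv \<le> 2 ^ ?tu" by (intro power_increasing) auto
    then have "list_wt K e v < list_wt K e u" using bv(2) bu(1) by linarith
    then show ?thesis using 2 idx by (auto simp: top_less int_prec_def)
  next
    case eq: 3
    then have "\<not> ?tu < ?tv" "\<not> ?tv < ?tu" by simp_all
    then have same: "max_coord u = max_coord v" "max_index u = max_index v"
      using idx by (auto simp: top_less)
    have skip: "skip m i < skip m j" if "i < j" for i j using that by (auto simp: skip_def)
    have skip_lt: "skip m i < Suc (Suc k)" if "i < Suc k" for i using that by (auto simp: skip_def)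
    have del: "length (delete_coord m u) = Suc k" "length (delete_coord m v) = Suc k"
      using idx 3 same by (auto simp: delete_coord_def m_def)
    have IH: "prec (Suc k) (delete_coord m u) (delete_coord m v) \<longleftrightarrow>
        list_wt K (e \<circ> skip m) (delete_coord m u) < list_wt K (e \<circ> skip m) (delete_coord m v)"
      unfolding m_def
    proof (rule 3(1)[folded same(2)])
      show "(e \<circ> skip (max_index u)) i < (e \<circ> skip (max_index u)) j" if "i < j" "j < Suc k" for i j
        using 3(5) skip[OF that(1)] skip_lt[OF that(2)] by (simp add: m_def)
      show "(e \<circ> skip (max_index u)) i < K" if "i < Suc k" for i
        using 3(6) skip_lt[OF that] by (simp add: m_def)
    qed (use del same in \<open>simp_all add: m_def\<close>)
    have "prec (Suc (Suc k)) u v \<longleftrightarrow> u \<noteq> v \<and> prec (Suc k) (delete_coord m u) (delete_coord m v)"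
      using same by (simp add: int_prec_def m_def)
    also have "\<dots> \<longleftrightarrow> list_wt K e u < list_wt K e v"
    proof -
      have "u ! m = v ! m" using same max_index(2)[OF ne(1)] max_index(2)[OF ne(2)] by (simp add: m_def)
      moreover have "m < length u" "m < length v" using idx 3(3,4) same by (simp_all add: m_def)
      ultimately have "list_wt K e u < list_wt K e v \<longleftrightarrow>
          list_wt K (e \<circ> skip m) (delete_coord m u) < list_wt K (e \<circ> skip m) (delete_coord m v)"
        by (simp add: list_wt_delete_coord)
      then show ?thesis using IH by auto
    qed
    finally show ?thesis .
  qed
qed simp

lemma prec_iff_wt_less:
  assumes "k \<ge> 1" "u \<in> Zn k" "v \<in> Zn k"
  shows "prec k u v \<longleftrightarrow> wt k {..<k} (coords u) < wt k {..<k} (coords v)"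
proof -
  have "list_wt k (\<lambda>i. i) w = wt k {..<k} (coords w)" if "w \<in> Zn k" for w
    using that by (simp add: list_wt_def wt_def coords_def Zn_def)
  then show ?thesis
    using prec_iff_list_wt_less[of k u v "\<lambda>i. i" k] assms by (simp add: Zn_def)
qed

theorem theorem1:
  fixes k :: nat and I A :: "int list set"
  assumes "k \<ge> 1"
    and "initial_segment k I"
    and "A \<subseteq> Zn k" and "finite A" and "A \<noteq> {}"
    and "card I = card A"
  shows "card (vertex_boundary k I) \<le> card (vertex_boundary k A)"
proof -
  have I: "I \<subseteq> Zn k" "finite I"
    using assms by (auto simp: initial_segment_def intro: card_ge_0_finite)
  have inj: "inj_on coords (Zn k)" and img: "coords ` Zn k = grid {..<k}"
    using bij_betw_coords by (auto simp: bij_betw_def)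
  have card: "card (coords ` B) = card B" if "B \<subseteq> Zn k" for B
    using inj that by (metis card_image inj_on_subset)
  have bdry: "card (vertex_boundary k B) = card (bdry {..<k} (coords ` B))" if "B \<subseteq> Zn k" for B
    using coords_vertex_boundary[OF assms(1) that] card[of "vertex_boundary k B"]
    by (auto simp: vertex_boundary_def)
  have "initial k {..<k} (coords ` I)"
    unfolding initial_def
  proof (intro conjI ballI impI)
    show "coords ` I \<subseteq> grid {..<k}" using I img by blast
    fix p q assume p: "p \<in> coords ` I" "q \<in> grid {..<k}" "wt k {..<k} q < wt k {..<k} p"
    then obtain u v where "u \<in> I" "p = coords u" "v \<in> Zn k" "q = coords v" using img by blast
    then show "q \<in> coords ` I"
      using p(3) prec_iff_wt_less[OF assms(1)] I(1) assms(2) by (auto simp: initial_segment_def)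
  qed
  then have "card (bdry {..<k} (coords ` I)) \<le> card (bdry {..<k} (coords ` A))"
    using I assms img card by (intro bdry_initial_le) auto
  then show ?thesis using bdry I(1) assms(3) by simp
qed

end
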